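(* Let $N\xrightarrow{\varphi}G$ be a crossed module of groupoids, and let $N\rtimes G\rightrightarrows N$ be the corresponding crossed product groupoid. Then the map $\rho$ from the product groupoid $\mathbb{Z}\times(N\rtimes G)\rightrightarrows N$ to the groupoid $N\rtimes G\rightrightarrows N$ defined by $$\rho(k,(x,g))=(x,\varphi(x^k)g)$$ is a groupoid homomorphism, covering the identity map of $N$ on objects.
   Context: For a groupoid $G\rightrightarrows G_0$ with source $s$ and target $t$, the product $gh$ is defined when $s(g)=t(h)$. A right action of $G\rightrightarrows G_0$ on a space $X$ consists of a momentum map $J:X\to G_0$ and a map $(x,g)\mapsto x^g$ defined when $J(x)=t(g)$, with $J(x^g)=s(g)$, $x^{gh}=(x^g)^h$, $x^{J(x)}=x$ (units identified with objects). The crossed product groupoid $X\rtimes G\rightrightarrows X$ has objects $X$, arrows $(x,g)$ with $J(x)=t(g)$, source $s(x,g)=x^g$, target $t(x,g)=x$, product $(x,g)(x^g,h)=(x,gh)$. $G$ acts on a groupoid $N\rightrightarrows N_0$ by automorphisms if $N_0$ and the arrow space $N$ are right $G$-spaces, the source and target maps of $N$ are $G$-equivariant, and $x^gy^g=(xy)^g$ whenever either side makes sense. A crossed module of groupoids $N\xrightarrow{\varphi}G$ is a groupoid homomorphism $\varphi$ from $N\rightrightarrows N_0$ to $G\rightrightarrows G_0$ with $N_0=G_0$ and $\varphi$ the identity on objects, where $N\rightrightarrows N_0$ is a bundle of groups (source equals target), together with a right action of $G$ on $N$ by automorphisms (the momentum map on $N$ is the bundle projection $N\to G_0$, and on $N_0=G_0$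 the action is $t(g)^g=s(g)$) such that (1) $\varphi(x^g)=\varphi(x)^g:=g^{-1}\varphi(x)g$ for all $x\in N$, $g\in G$ such that $x^g$ makes sense, and (2) $x^{\varphi(y)}=x^y:=y^{-1}xy$ for all composable $x,y\in N$. The crossed product groupoid $N\rtimes G\rightrightarrows N$ is that of the action of $G$ on the arrow space $N$. The group $\mathbb{Z}$ is viewed as a groupoid with one object $\bullet$; the product groupoid $\mathbb{Z}\times(N\rtimes G)$ has object space $\{\bullet\}\times N=N$ and componentwise structure maps. For $k\in\mathbb{Z}$, $x^k$ denotes the $k$-th power of $x$ in the fibre group of $N$ containing $x$. *)

theory Defs
  imports "HOL-Algebra.Elementary_Groups"
begin

text \<open>
  Units are identified with objects in the mathematical text; here \<open>Unit G a\<close> is the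
  unit arrow at the object \<open>a\<close>.  \<open>Comp G g h\<close> is the product \<open>gh\<close>, meaningful
  when \<open>Src G g = Tgt G h\<close>.  All maps are relevant only on the carriers \<open>Obj\<close> and \<open>Arr\<close>.
\<close>

record ('o, 'a) groupoid_struct =
  Obj :: "'o set"
  Arr :: "'a set"
  Src :: "'a \<Rightarrow> 'o"
  Tgt :: "'a \<Rightarrow> 'o"
  Comp :: "'a \<Rightarrow> 'a \<Rightarrow> 'a"
  Unit :: "'o \<Rightarrow> 'a"
  Inv :: "'a \<Rightarrow> 'a"

locale groupoid =
  fixes G :: "('o, 'a) groupoid_struct"
  assumes Src_closed: "g \<in> Arr G \<Longrightarrow> Src G g \<in> Obj G"
    and Tgt_closed: "g \<in> Arr G \<Longrightarrow> Tgt G g \<in> Obj G"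
    and Comp_closed: "\<lbrakk>g \<in> Arr G; h \<in> Arr G; Src G g = Tgt G h\<rbrakk> \<Longrightarrow> Comp G g h \<in> Arr G"
    and Src_Comp: "\<lbrakk>g \<in> Arr G; h \<in> Arr G; Src G g = Tgt G h\<rbrakk> \<Longrightarrow> Src G (Comp G g h) = Src G h"
    and Tgt_Comp: "\<lbrakk>g \<in> Arr G; h \<in> Arr G; Src G g = Tgt G h\<rbrakk> \<Longrightarrow> Tgt G (Comp G g h) = Tgt G g"
    and Comp_assoc:
      "\<lbrakk>g \<in> Arr G; h \<in> Arr G; k \<in> Arr G; Src G g = Tgt G h; Src G h = Tgt G k\<rbrakk>
        \<Longrightarrow> Comp G (Comp G g h) k = Comp G g (Comp G h k)"
    and Unit_closed: "a \<in> Obj G \<Longrightarrow> Unit G a \<in> Arr G"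
    and Src_Unit: "a \<in> Obj G \<Longrightarrow> Src G (Unit G a) = a"
    and Tgt_Unit: "a \<in> Obj G \<Longrightarrow> Tgt G (Unit G a) = a"
    and Unit_left: "g \<in> Arr G \<Longrightarrow> Comp G (Unit G (Tgt G g)) g = g"
    and Unit_right: "g \<in> Arr G \<Longrightarrow> Comp G g (Unit G (Src G g)) = g"
    and Inv_closed: "g \<in> Arr G \<Longrightarrow> Inv G g \<in> Arr G"
    and Src_Inv: "g \<in> Arr G \<Longrightarrow> Src G (Inv G g) = Tgt G g"
    and Tgt_Inv: "g \<in> Arr G \<Longrightarrow> Tgt G (Inv G g) = Src G g"
    and Inv_right: "g \<in> Arr G \<Longrightarrow> Comp G g (Inv G g) = Unit G (Tgt G g)"
    and Inv_left: "g \<in> Arr G \<Longrightarrow> Comp G (Inv G g) g = Unit G (Src G g)"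

text \<open>A homomorphism \<open>f\<close> covering the map \<open>f0\<close> on objects.\<close>

locale groupoid_hom = dom: groupoid G + cod: groupoid H
  for G :: "('o, 'a) groupoid_struct" and H :: "('p, 'b) groupoid_struct" +
  fixes f :: "'a \<Rightarrow> 'b" and f0 :: "'o \<Rightarrow> 'p"
  assumes hom_Obj: "a \<in> Obj G \<Longrightarrow> f0 a \<in> Obj H"
    and hom_Arr: "g \<in> Arr G \<Longrightarrow> f g \<in> Arr H"
    and hom_Src: "g \<in> Arr G \<Longrightarrow> Src H (f g) = f0 (Src G g)"
    and hom_Tgt: "g \<in> Arr G \<Longrightarrow> Tgt H (f g) = f0 (Tgt G g)"
    and hom_Unit: "a \<in> Obj G \<Longrightarrow> f (Unit G a) = Unit H (f0 a)"
    and hom_Comp: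
      "\<lbrakk>g \<in> Arr G; h \<in> Arr G; Src G g = Tgt G h\<rbrakk> \<Longrightarrow> f (Comp G g h) = Comp H (f g) (f h)"

definition group_groupoid :: "('a, 'm) monoid_scheme \<Rightarrow> (unit, 'a) groupoid_struct" where
  "group_groupoid M =
    \<lparr>Obj = {()}, Arr = carrier M, Src = (\<lambda>_. ()), Tgt = (\<lambda>_. ()),
     Comp = (\<lambda>g h. g \<otimes>\<^bsub>M\<^esub> h), Unit = (\<lambda>_. \<one>\<^bsub>M\<^esub>), Inv = (\<lambda>g. inv\<^bsub>M\<^esub> g)\<rparr>"

definition prod_groupoid ::
  "('o, 'a) groupoid_struct \<Rightarrow> ('p, 'b) groupoid_struct \<Rightarrow> ('o \<times> 'p, 'a \<times> 'b) groupoid_struct" where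
  "prod_groupoid G H =
    \<lparr>Obj = Obj G \<times> Obj H, Arr = Arr G \<times> Arr H,
     Src = map_prod (Src G) (Src H), Tgt = map_prod (Tgt G) (Tgt H),
     Comp = (\<lambda>(g, h) (g', h'). (Comp G g g', Comp H h h')),
     Unit = map_prod (Unit G) (Unit H), Inv = map_prod (Inv G) (Inv H)\<rparr>"

locale right_action = groupoid G
  for G :: "('o, 'a) groupoid_struct" +
  fixes X :: "'x set" and J :: "'x \<Rightarrow> 'o" and act :: "'x \<Rightarrow> 'a \<Rightarrow> 'x"
  assumes J_closed: "x \<in> X \<Longrightarrow> J x \<in> Obj G"
    and act_closed: "\<lbrakk>x \<in> X; g \<in> Arr G; J x = Tgt G g\<rbrakk> \<Longrightarrow> act x g \<in> X"
    and J_act: "\<lbrakk>x \<in> X; g \<in> Arr G; J x = Tgt G g\<rbrakk> \<Longrightarrow> J (act x g) = Src G g"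
    and act_Comp:
      "\<lbrakk>x \<in> X; g \<in> Arr G; h \<in> Arr G; J x = Tgt G g; Src G g = Tgt G h\<rbrakk>
        \<Longrightarrow> act x (Comp G g h) = act (act x g) h"
    and act_Unit: "x \<in> X \<Longrightarrow> act x (Unit G (J x)) = x"

definition crossed_product ::
  "('o, 'a) groupoid_struct \<Rightarrow> 'x set \<Rightarrow> ('x \<Rightarrow> 'o) \<Rightarrow> ('x \<Rightarrow> 'a \<Rightarrow> 'x)
    \<Rightarrow> ('x, 'x \<times> 'a) groupoid_struct" where
  "crossed_product G X J act =
    \<lparr>Obj = X, Arr = {(x, g). x \<in> X \<and> g \<in> Arr G \<and> J x = Tgt G g},
     Src = (\<lambda>(x, g). act x g), Tgt = (\<lambda>(x, g). x),
     Comp = (\<lambda>(x, g) (y, h). (x, Comp G g h)),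
     Unit = (\<lambda>x. (x, Unit G (J x))), Inv = (\<lambda>(x, g). (act x g, Inv G g))\<rparr>"

text \<open>
  The disjunction in \<open>act_mult\<close> spells out that one of the sides \<open>x\<^sup>g y\<^sup>g\<close> and
  \<open>(xy)\<^sup>g\<close> is defined.
\<close>

locale action_by_automorphisms =
  N: groupoid N +
  obj: right_action G "Obj N" J0 act0 +
  arr: right_action G "Arr N" J act
  for G :: "('o, 'a) groupoid_struct" and N :: "('p, 'n) groupoid_struct"
    and J0 :: "'p \<Rightarrow> 'o" and act0 :: "'p \<Rightarrow> 'a \<Rightarrow> 'p"
    and J :: "'n \<Rightarrow> 'o" and act :: "'n \<Rightarrow> 'a \<Rightarrow> 'n" +
  assumes J_Src: "x \<in> Arr N \<Longrightarrow> J0 (Src N x) = J x"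
    and J_Tgt: "x \<in> Arr N \<Longrightarrow> J0 (Tgt N x) = J x"
    and Src_act: "\<lbrakk>x \<in> Arr N; g \<in> Arr G; J x = Tgt G g\<rbrakk> \<Longrightarrow> Src N (act x g) = act0 (Src N x) g"
    and Tgt_act: "\<lbrakk>x \<in> Arr N; g \<in> Arr G; J x = Tgt G g\<rbrakk> \<Longrightarrow> Tgt N (act x g) = act0 (Tgt N x) g"
    and act_mult:
      "\<lbrakk>x \<in> Arr N; y \<in> Arr N; g \<in> Arr G;
        (J x = Tgt G g \<and> J y = Tgt G g \<and> Src N (act x g) = Tgt N (act y g)) \<or>
        (Src N x = Tgt N y \<and> J (Comp N x y) = Tgt G g)\<rbrakk>
        \<Longrightarrow> Comp N (act x g) (act y g) = act (Comp N x y) g"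

locale crossed_module =
  hom: groupoid_hom N G \<phi> "\<lambda>a. a" +
  aut: action_by_automorphisms G N "\<lambda>a. a" "\<lambda>_ g. Src G g" "Src N" act
  for N :: "('o, 'n) groupoid_struct" and G :: "('o, 'a) groupoid_struct"
    and \<phi> :: "'n \<Rightarrow> 'a" and act :: "'n \<Rightarrow> 'a \<Rightarrow> 'n" +
  assumes same_Obj: "Obj N = Obj G"
    and Src_eq_Tgt: "x \<in> Arr N \<Longrightarrow> Src N x = Tgt N x"
    and equivariance:
      "\<lbrakk>x \<in> Arr N; g \<in> Arr G; Src N x = Tgt G g\<rbrakk>
        \<Longrightarrow> \<phi> (act x g) = Comp G (Comp G (Inv G g) (\<phi> x)) g"
    and peiffer:
      "\<lbrakk>x \<in> Arr N; y \<in> Arr N; Src N x = Tgt N y\<rbrakk>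
        \<Longrightarrow> act x (\<phi> y) = Comp N (Comp N (Inv N y) x) y"

definition fibre_group :: "('o, 'n) groupoid_struct \<Rightarrow> 'o \<Rightarrow> 'n monoid" where
  "fibre_group N a =
    \<lparr>carrier = {x \<in> Arr N. Src N x = a \<and> Tgt N x = a}, monoid.mult = Comp N, one = Unit N a\<rparr>"

definition rho ::
  "('o, 'n) groupoid_struct \<Rightarrow> ('o, 'a) groupoid_struct \<Rightarrow> ('n \<Rightarrow> 'a)
    \<Rightarrow> int \<times> 'n \<times> 'a \<Rightarrow> 'n \<times> 'a" where
  "rho N G \<phi> = (\<lambda>(k, (x, g)). (x, Comp G (\<phi> (x [^]\<^bsub>fibre_group N (Src N x)\<^esub> k)) g))"

end

theory Submission
  imports Defs
begin

text \<open>
  The map \<open>\<rho>\<close> preserves sources by the Peiffer identity, which gives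
  \<open>x\<^bsup>\<phi>(x\<^sup>k)\<^esup> = x\<^sup>-\<^sup>k x x\<^sup>k = x\<close>, because powers of \<open>x\<close> commute with \<open>x\<close>.  So \<open>(x, \<phi>(x\<^sup>k))\<close> is an element
  of the isotropy group of \<open>N \<rtimes> G\<close> at the object \<open>x\<close>, and composing \<open>(x, g)\<close> with it on the left
  does not change source or target.

  Multiplicativity amounts to saying that this family of isotropy elements is natural, that is,
  \<open>g \<phi>((x\<^sup>g)\<^sup>l) = \<phi>(x\<^sup>l) g\<close>.  This holds because \<open>g\<close> acts by group homomorphisms between the
  fibres, so \<open>(x\<^sup>g)\<^sup>l = (x\<^sup>l)\<^sup>g\<close>, and equivariance turns \<open>\<phi>((x\<^sup>l)\<^sup>g)\<close> into \<open>g\<^sup>-\<^sup>1 \<phi>(x\<^sup>l) g\<close>.  For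
  composable \<open>(x, g)\<close> and \<open>(x\<^sup>g, h)\<close> one then gets
  \<open>\<phi>(x\<^sup>k) g \<phi>((x\<^sup>g)\<^sup>l) h = \<phi>(x\<^sup>k) \<phi>(x\<^sup>l) g h = \<phi>(x\<^bsup>k+l\<^esup>) g h\<close>.
\<close>

lemma groupoid_group_groupoid:
  assumes "group M"
  shows "groupoid (group_groupoid M)"
proof -
  interpret group M by fact
  show ?thesis
    by unfold_locales (auto simp: group_groupoid_def m_assoc)
qed

lemma groupoid_prod_groupoid:
  assumes "groupoid G" "groupoid H"
  shows "groupoid (prod_groupoid G H)"
proof -
  interpret G: groupoid G by fact
  interpret H: groupoid H by fact
  note G_laws = G.Src_closed G.Tgt_closed G.Comp_closed G.Src_Comp G.Tgt_Comp G.Comp_assoc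
    G.Unit_closed G.Src_Unit G.Tgt_Unit G.Unit_left G.Unit_right G.Inv_closed G.Src_Inv
    G.Tgt_Inv G.Inv_right G.Inv_left
  note H_laws = H.Src_closed H.Tgt_closed H.Comp_closed H.Src_Comp H.Tgt_Comp H.Comp_assoc
    H.Unit_closed H.Src_Unit H.Tgt_Unit H.Unit_left H.Unit_right H.Inv_closed H.Src_Inv
    H.Tgt_Inv H.Inv_right H.Inv_left
  show ?thesis
    by unfold_locales (auto simp: prod_groupoid_def G_laws H_laws)
qed

lemma (in right_action) groupoid_crossed_product:
  "groupoid (crossed_product G X J act)"
proof -
  have act_Unit_Tgt: "act x (Unit G (Tgt G g)) = x" if "x \<in> X" "J x = Tgt G g" for x g
    using act_Unit[OF that(1)] that(2) by simp
  have act_Inv: "act (act x g) (Inv G g) = x" if "x \<in> X" "g \<in> Arr G" "J x = Tgt G g" for x g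
    using that act_Comp[of x g "Inv G g"] act_Unit[of x]
    by (simp add: Inv_closed Tgt_Inv Inv_right)
  show ?thesis
    by unfold_locales
      (auto simp: crossed_product_def act_Inv act_Unit_Tgt J_closed act_closed J_act act_Comp act_Unit
        Src_closed Tgt_closed Comp_closed Src_Comp Tgt_Comp Comp_assoc Unit_closed Src_Unit
        Tgt_Unit Unit_left Unit_right Inv_closed Src_Inv Tgt_Inv Inv_right Inv_left)
qed

lemma (in groupoid) group_fibre_group:
  assumes a: "a \<in> Obj G"
  shows "group (fibre_group G a)"
proof (rule groupI)
  fix x assume x: "x \<in> carrier (fibre_group G a)"
  show "\<exists>y\<in>carrier (fibre_group G a). y \<otimes>\<^bsub>fibre_group G a\<^esub> x = \<one>\<^bsub>fibre_group G a\<^esub>"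
    using x by (intro bexI[of _ "Inv G x"])
      (auto simp: fibre_group_def Inv_closed Src_Inv Tgt_Inv Inv_left)
next
  fix x assume "x \<in> carrier (fibre_group G a)"
  then show "\<one>\<^bsub>fibre_group G a\<^esub> \<otimes>\<^bsub>fibre_group G a\<^esub> x = x"
    using Unit_left[of x] by (auto simp: fibre_group_def)
qed (auto simp: fibre_group_def Comp_closed Src_Comp Tgt_Comp Comp_assoc Unit_closed
    Src_Unit Tgt_Unit a)

context crossed_module
begin

abbreviation fibre_pow :: "'n \<Rightarrow> int \<Rightarrow> 'n" where
  "fibre_pow x k \<equiv> x [^]\<^bsub>fibre_group N (Src N x)\<^esub> k"

lemma group_fibre: "x \<in> Arr N \<Longrightarrow> group (fibre_group N (Src N x))"
  by (simp add: hom.dom.group_fibre_group hom.dom.Src_closed)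

lemma mem_fibre: "x \<in> Arr N \<Longrightarrow> x \<in> carrier (fibre_group N (Src N x))"
  by (simp add: fibre_group_def Src_eq_Tgt)

lemma fibre_pow_in_Arr: "x \<in> Arr N \<Longrightarrow> fibre_pow x k \<in> Arr N"
  and Src_fibre_pow: "x \<in> Arr N \<Longrightarrow> Src N (fibre_pow x k) = Src N x"
  and Tgt_fibre_pow: "x \<in> Arr N \<Longrightarrow> Tgt N (fibre_pow x k) = Src N x"
  using group.int_pow_closed[OF group_fibre mem_fibre, of x k]
  by (auto simp: fibre_group_def)

lemma fibre_pow_add:
  "x \<in> Arr N \<Longrightarrow> fibre_pow x (k + l) = Comp N (fibre_pow x k) (fibre_pow x l)"
  using group.int_pow_mult[OF group_fibre mem_fibre, of x k l]
  by (simp add: fibre_group_def)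

lemma fibre_pow_commute:
  assumes x: "x \<in> Arr N"
  shows "Comp N x (fibre_pow x k) = Comp N (fibre_pow x k) x"
proof -
  have "fibre_pow x 1 = x"
    using group.int_pow_1[OF group_fibre mem_fibre] x by simp
  then show ?thesis
    using fibre_pow_add[OF x, of 1 k] fibre_pow_add[OF x, of k 1] by (simp add: add.commute)
qed

text \<open>
  An arrow of \<open>G\<close> acts on a whole fibre by a group homomorphism, and homomorphisms of groups
  respect integer powers.
\<close>

lemma act_fibre_pow:
  assumes x: "x \<in> Arr N" and g: "g \<in> Arr G" and xg: "Src N x = Tgt G g"
  shows "act (fibre_pow x k) g = fibre_pow (act x g) k"
proof -
  have Src_act: "Src N (act x g) = Src G g"
    using x g xg by (rule aut.arr.J_act)
  have "(\<lambda>y. act y g) \<in> hom (fibre_group N (Src N x)) (fibre_group N (Src G g))"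
    using g xg by (auto simp: hom_def fibre_group_def aut.arr.act_closed aut.arr.J_act
        Src_eq_Tgt[symmetric] aut.act_mult hom.dom.Src_Comp)
  then interpret act: group_hom "fibre_group N (Src N x)" "fibre_group N (Src G g)" "\<lambda>y. act y g"
    using group_fibre[OF x] hom.dom.group_fibre_group g
    by (auto simp: group_hom_def group_hom_axioms_def same_Obj hom.cod.Src_closed)
  show ?thesis
    using act.hom_int_pow[OF mem_fibre[OF x]] by (simp add: Src_act)
qed

lemma image_fibre_pow_in_Arr: "x \<in> Arr N \<Longrightarrow> \<phi> (fibre_pow x k) \<in> Arr G"
  and Src_image_fibre_pow: "x \<in> Arr N \<Longrightarrow> Src G (\<phi> (fibre_pow x k)) = Src N x"
  and Tgt_image_fibre_pow: "x \<in> Arr N \<Longrightarrow> Tgt G (\<phi> (fibre_pow x k)) = Src N x"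
  by (simp_all add: hom.hom_Arr hom.hom_Src hom.hom_Tgt fibre_pow_in_Arr Src_fibre_pow
      Tgt_fibre_pow)

text \<open>
  By the Peiffer identity the action of \<open>\<phi>(x\<^sup>k)\<close> on \<open>x\<close> is conjugation by a power of \<open>x\<close>, which
  commutes with \<open>x\<close>.
\<close>

lemma act_image_fibre_pow:
  assumes x: "x \<in> Arr N"
  shows "act x (\<phi> (fibre_pow x k)) = x"
proof -
  let ?y = "fibre_pow x k"
  note y = fibre_pow_in_Arr[OF x, of k] Src_fibre_pow[OF x, of k] Tgt_fibre_pow[OF x, of k]
  have tx: "Tgt N x = Src N x"
    by (simp only: Src_eq_Tgt[OF x])
  have "act x (\<phi> ?y) = Comp N (Comp N (Inv N ?y) x) ?y"
    using x y by (simp add: peiffer)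
  also have "\<dots> = Comp N (Inv N ?y) (Comp N x ?y)"
    using x y by (simp add: hom.dom.Comp_assoc hom.dom.Inv_closed hom.dom.Src_Inv tx)
  also have "\<dots> = Comp N (Comp N (Inv N ?y) ?y) x"
    using x y by (simp add: fibre_pow_commute hom.dom.Comp_assoc hom.dom.Inv_closed
        hom.dom.Src_Inv tx)
  also have "\<dots> = x"
    using x y hom.dom.Unit_left[OF x] by (simp add: hom.dom.Inv_left tx)
  finally show ?thesis .
qed

text \<open>
  The isotropy elements \<open>\<phi>(x\<^sup>l)\<close> form a natural family: conjugation by the
  arrow \<open>(x, g)\<close> from \<open>x\<^sup>g\<close> to \<open>x\<close> carries the one at \<open>x\<^sup>g\<close> to the one at \<open>x\<close>.  Equivariance gives
  this once \<open>(x\<^sup>g)\<^sup>l\<close> is rewritten as \<open>(x\<^sup>l)\<^sup>g\<close>.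
\<close>

lemma image_fibre_pow_natural:
  assumes x: "x \<in> Arr N" and g: "g \<in> Arr G" and xg: "Src N x = Tgt G g"
  shows "Comp G g (\<phi> (fibre_pow (act x g) l)) = Comp G (\<phi> (fibre_pow x l)) g"
proof -
  let ?p = "\<phi> (fibre_pow x l)"
  note p = image_fibre_pow_in_Arr[OF x, of l] Src_image_fibre_pow[OF x, of l]
    Tgt_image_fibre_pow[OF x, of l]
  note inv = hom.cod.Inv_closed[OF g] hom.cod.Src_Inv[OF g] hom.cod.Tgt_Inv[OF g]
  have pg: "Comp G ?p g \<in> Arr G" "Tgt G (Comp G ?p g) = Tgt G g"
    using p g xg by (simp_all add: hom.cod.Comp_closed hom.cod.Tgt_Comp)
  have "\<phi> (fibre_pow (act x g) l) = \<phi> (act (fibre_pow x l) g)"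
    by (simp only: act_fibre_pow[OF x g xg])
  also have "\<dots> = Comp G (Comp G (Inv G g) ?p) g"
    using equivariance[OF fibre_pow_in_Arr[OF x, of l] g] Src_fibre_pow[OF x, of l] xg by simp
  also have "\<dots> = Comp G (Inv G g) (Comp G ?p g)"
    using p inv g xg by (simp add: hom.cod.Comp_assoc)
  finally have "Comp G g (\<phi> (fibre_pow (act x g) l))
      = Comp G g (Comp G (Inv G g) (Comp G ?p g))" by simp
  also have "\<dots> = Comp G (Comp G g (Inv G g)) (Comp G ?p g)"
    using pg inv g by (simp add: hom.cod.Comp_assoc)
  also have "\<dots> = Comp G ?p g"
    using pg g hom.cod.Unit_left[OF pg(1)] by (simp add: hom.cod.Inv_right)
  finally show ?thesis .
qed

lemma image_fibre_pow_mult: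
  assumes x: "x \<in> Arr N" and g: "g \<in> Arr G" and h: "h \<in> Arr G"
    and xg: "Src N x = Tgt G g" and gh: "Src G g = Tgt G h"
  shows "Comp G (\<phi> (fibre_pow x (k + l))) (Comp G g h)
    = Comp G (Comp G (\<phi> (fibre_pow x k)) g) (Comp G (\<phi> (fibre_pow (act x g) l)) h)"
proof -
  let ?p = "\<lambda>m. \<phi> (fibre_pow x m)" and ?q = "\<phi> (fibre_pow (act x g) l)"
  note p = image_fibre_pow_in_Arr[OF x] Src_image_fibre_pow[OF x] Tgt_image_fibre_pow[OF x]
  have y: "act x g \<in> Arr N" "Src N (act x g) = Src G g"
    using x g xg by (simp_all add: aut.arr.act_closed aut.arr.J_act)
  have q: "?q \<in> Arr G" "Src G ?q = Src G g" "Tgt G ?q = Src G g"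
    using image_fibre_pow_in_Arr[OF y(1), of l] Src_image_fibre_pow[OF y(1), of l]
      Tgt_image_fibre_pow[OF y(1), of l] y(2) by simp_all
  note laws = hom.cod.Comp_assoc hom.cod.Comp_closed hom.cod.Src_Comp hom.cod.Tgt_Comp
  have "Comp G (Comp G (?p k) g) (Comp G ?q h) = Comp G (?p k) (Comp G (Comp G g ?q) h)"
    using p q g h xg gh by (simp add: laws)
  also have "\<dots> = Comp G (?p k) (Comp G (Comp G (?p l) g) h)"
    using x g xg by (simp only: image_fibre_pow_natural)
  also have "\<dots> = Comp G (Comp G (?p k) (?p l)) (Comp G g h)"
    using p g h xg gh by (simp add: laws)
  also have "Comp G (?p k) (?p l) = ?p (k + l)"
    using x by (simp add: fibre_pow_add hom.hom_Comp fibre_pow_in_Arr Src_fibre_pow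
        Tgt_fibre_pow)
  finally show ?thesis by simp
qed

end

theorem lemma9:
  fixes N :: "('o, 'n) groupoid_struct" and G :: "('o, 'a) groupoid_struct"
    and \<phi> :: "'n \<Rightarrow> 'a" and act :: "'n \<Rightarrow> 'a \<Rightarrow> 'n"
  assumes "crossed_module N G \<phi> act"
  shows "groupoid_hom
           (prod_groupoid (group_groupoid integer_group) (crossed_product G (Arr N) (Src N) act))
           (crossed_product G (Arr N) (Src N) act)
           (rho N G \<phi>) (\<lambda>(_, x). x)"
proof -
  interpret crossed_module N G \<phi> act by fact
  let ?C = "crossed_product G (Arr N) (Src N) act"
  let ?P = "prod_groupoid (group_groupoid integer_group) ?C"
  note defs = prod_groupoid_def group_groupoid_def crossed_product_def rho_def
  have C: "groupoid ?C"
    by (rule aut.arr.groupoid_crossed_product)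
  have P: "groupoid ?P"
    by (intro groupoid_prod_groupoid groupoid_group_groupoid group_integer_group C)
  have "groupoid_hom_axioms ?P ?C (rho N G \<phi>) (\<lambda>(_, x). x)"
  proof (rule groupoid_hom_axioms.intro)
    fix a assume "a \<in> Obj ?P"
    then show "(case a of (_, x) \<Rightarrow> x) \<in> Obj ?C"
      by (auto simp: defs)
  next
    fix u assume "u \<in> Arr ?P"
    then obtain k x g where u: "u = (k, x, g)" "x \<in> Arr N" "g \<in> Arr G" "Src N x = Tgt G g"
      by (auto simp: defs)
    note p = image_fibre_pow_in_Arr[OF u(2), of k] Src_image_fibre_pow[OF u(2), of k]
      Tgt_image_fibre_pow[OF u(2), of k]
    show "rho N G \<phi> u \<in> Arr ?C"
      using u p by (simp add: defs hom.cod.Comp_closed hom.cod.Tgt_Comp)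
    show "Tgt ?C (rho N G \<phi> u) = (case Tgt ?P u of (_, x) \<Rightarrow> x)"
      using u by (simp add: defs)
    show "Src ?C (rho N G \<phi> u) = (case Src ?P u of (_, x) \<Rightarrow> x)"
      using u p act_image_fibre_pow[OF u(2), of k] by (simp add: defs aut.arr.act_Comp)
  next
    fix a assume "a \<in> Obj ?P"
    then obtain x where a: "a = ((), x)" and x: "x \<in> Arr N"
      by (auto simp: defs)
    let ?e = "Unit G (Src N x)"
    have o: "Src N x \<in> Obj G" "Src N x \<in> Obj N"
      using x by (simp_all add: hom.dom.Src_closed same_Obj[symmetric])
    have "fibre_pow x 0 = Unit N (Src N x)"
      by (simp add: fibre_group_def)
    then have "\<phi> (fibre_pow x 0) = ?e"
      using o by (simp add: hom.hom_Unit)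
    moreover have "Comp G ?e ?e = ?e"
      using hom.cod.Unit_left[of ?e] o by (simp add: hom.cod.Unit_closed hom.cod.Tgt_Unit)
    ultimately show "rho N G \<phi> (Unit ?P a) = Unit ?C (case a of (_, x) \<Rightarrow> x)"
      using a by (simp add: defs)
  next
    fix u v assume "u \<in> Arr ?P" "v \<in> Arr ?P" "Src ?P u = Tgt ?P v"
    then obtain k x g l h where uv: "u = (k, x, g)" "v = (l, act x g, h)"
      and x: "x \<in> Arr N" and gh: "g \<in> Arr G" "h \<in> Arr G" and xg: "Src N x = Tgt G g"
      and yh: "Src N (act x g) = Tgt G h"
      by (auto simp: defs)
    have "Src G g = Tgt G h"
      using aut.arr.J_act[OF x gh(1) xg] yh by simp
    then show "rho N G \<phi> (Comp ?P u v) = Comp ?C (rho N G \<phi> u) (rho N G \<phi> v)"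
      using image_fibre_pow_mult[OF x gh xg] by (simp add: uv defs)
  qed
  with C P show ?thesis
    by (simp add: groupoid_hom_def)
qed

end
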